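(* For any fixed connected pattern graph $Q$ with $O(1)$ vertices, there is a data structure for the Range Subgraph Counting problem that uses $O(n^2)$ space and answers a query in $\tilde{O}(1)$ time.
   Context: Range Subgraph Counting: $G=(V,E)$ is an undirected graph with $n=|V|$ vertices, each vertex $v$ carrying a real-valued attribute $A_v$. For an interval $q=[x_1,x_2]$, $G_q$ is the subgraph of $G$ induced by $\{v\in V\mid x_1\le A_v\le x_2\}$. A query, given $q$, returns the number of occurrences (subgraphs isomorphic to $Q$) of $Q$ in $G_q$. $\tilde{O}(\cdot)$ hides polylogarithmic factors. *)

theory Defs
  imports Complex_Main "HOL-Library.Landau_Symbols"
begin

section \<open>Finite simple graphs and pattern occurrences\<close>

record 'a graph =
  verts :: "'a set"
  edges :: "'a set set"

definition simple_graph :: "'a graph \<Rightarrow> bool" where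
  "simple_graph G \<longleftrightarrow> finite (verts G) \<and>
     edges G \<subseteq> {{u, v} | u v. u \<in> verts G \<and> v \<in> verts G \<and> u \<noteq> v}"

definition connected_graph :: "'a graph \<Rightarrow> bool" where
  "connected_graph G \<longleftrightarrow> verts G \<noteq> {} \<and>
     (\<forall>u\<in>verts G. \<forall>v\<in>verts G. (\<lambda>a b. {a, b} \<in> edges G)\<^sup>*\<^sup>* u v)"

definition induced :: "'a graph \<Rightarrow> 'a set \<Rightarrow> 'a graph" where
  "induced G U = \<lparr>verts = verts G \<inter> U, edges = {e \<in> edges G. e \<subseteq> U}\<rparr>"

definition subgraph :: "'a graph \<Rightarrow> 'a graph \<Rightarrow> bool" where
  "subgraph H G \<longleftrightarrow> simple_graph H \<and> verts H \<subseteq> verts G \<and> edges H \<subseteq> edges G"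

definition graph_iso :: "'a graph \<Rightarrow> 'b graph \<Rightarrow> bool" where
  "graph_iso H Q \<longleftrightarrow>
     (\<exists>f. bij_betw f (verts H) (verts Q) \<and> edges Q = (\<lambda>e. f ` e) ` edges H)"

text \<open>Occurrences are subgraphs, not necessarily induced ones, and they are counted as
  subgraphs rather than as embeddings: automorphisms of the pattern do not contribute.\<close>

definition num_occurrences :: "'q graph \<Rightarrow> 'v graph \<Rightarrow> nat" where
  "num_occurrences Q G = card {H. subgraph H G \<and> graph_iso H Q}"

definition range_subgraph :: "'v graph \<Rightarrow> ('v \<Rightarrow> real) \<Rightarrow> real \<Rightarrow> real \<Rightarrow> 'v graph" where
  "range_subgraph G A x1 x2 = induced G {v. x1 \<le> A v \<and> A v \<le> x2}"

section \<open>Word RAM with comparable real keys\<close>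

text \<open>
  All instructions have unit cost. Word cells and word registers hold numbers below
  \<open>2 ^ w\<close>, where \<open>w\<close> is the word length, and word arithmetic is modulo \<open>2 ^ w\<close>.
  Attributes and query end points are reals; they live in separate cells and registers, which
  can only be copied and compared. There is no arithmetic, rounding or conversion on reals,
  so a real cell cannot be used to pack a table into a single number.
\<close>

datatype binop = Add | Sub | Mul | Div | Mod | And | Or | Xor | Shl | Shr

fun eval_binop :: "nat \<Rightarrow> binop \<Rightarrow> nat \<Rightarrow> nat \<Rightarrow> nat" where
  "eval_binop w Add a b = (a + b) mod 2 ^ w"
| "eval_binop w Sub a b = (a + 2 ^ w - b) mod 2 ^ w"
| "eval_binop w Mul a b = (a * b) mod 2 ^ w"
| "eval_binop w Div a b = (a div b) mod 2 ^ w"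
| "eval_binop w Mod a b = (a mod b) mod 2 ^ w"
| "eval_binop w And a b = (and a b) mod 2 ^ w"
| "eval_binop w Or a b = (or a b) mod 2 ^ w"
| "eval_binop w Xor a b = (xor a b) mod 2 ^ w"
| "eval_binop w Shl a b = push_bit b a mod 2 ^ w"
| "eval_binop w Shr a b = drop_bit b a mod 2 ^ w"

text \<open>Register operands are register numbers, jump operands are absolute program positions.
  In \<open>Load d i\<close> and \<open>Store i s\<close> (and their real variants) the cell address is
  the content of word register \<open>i\<close>.\<close>

datatype instr =
    Const nat nat
  | Move nat nat
  | Op binop nat nat nat
  | Load nat nat
  | Store nat nat
  | RMove nat nat
  | RLoad nat nat
  | RStore nat nat
  | Jump nat
  | JumpLess nat nat nat
  | RJumpLess nat nat nat
  | Halt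

record config =
  pc :: nat
  reg :: "nat \<Rightarrow> nat"
  rreg :: "nat \<Rightarrow> real"
  mem :: "nat list"
  rmem :: "real list"

abbreviation advance :: "config \<Rightarrow> config" where
  "advance c \<equiv> c\<lparr>pc := Suc (pc c)\<rparr>"

text \<open>The two memories have fixed length; the machine gets stuck (\<open>None\<close>) on access out
  of bounds. Hence the initial memory lengths account for all cells used, scratch space
  included, apart from the registers, of which a program mentions only a constant number.\<close>

fun exec :: "nat \<Rightarrow> instr \<Rightarrow> config \<Rightarrow> config option" where
  "exec w (Const d k) c = Some (advance (c\<lparr>reg := (reg c)(d := k mod 2 ^ w)\<rparr>))"
| "exec w (Move d s) c = Some (advance (c\<lparr>reg := (reg c)(d := reg c s)\<rparr>))"
| "exec w (Op f d a b) c =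
     Some (advance (c\<lparr>reg := (reg c)(d := eval_binop w f (reg c a) (reg c b))\<rparr>))"
| "exec w (Load d i) c =
     (if reg c i < length (mem c)
      then Some (advance (c\<lparr>reg := (reg c)(d := mem c ! reg c i)\<rparr>)) else None)"
| "exec w (Store i s) c =
     (if reg c i < length (mem c)
      then Some (advance (c\<lparr>mem := (mem c)[reg c i := reg c s]\<rparr>)) else None)"
| "exec w (RMove d s) c = Some (advance (c\<lparr>rreg := (rreg c)(d := rreg c s)\<rparr>))"
| "exec w (RLoad d i) c =
     (if reg c i < length (rmem c)
      then Some (advance (c\<lparr>rreg := (rreg c)(d := rmem c ! reg c i)\<rparr>)) else None)"
| "exec w (RStore i s) c =
     (if reg c i < length (rmem c)
      then Some (advance (c\<lparr>rmem := (rmem c)[reg c i := rreg c s]\<rparr>)) else None)"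
| "exec w (Jump l) c = Some (c\<lparr>pc := l\<rparr>)"
| "exec w (JumpLess a b l) c =
     Some (if reg c a < reg c b then c\<lparr>pc := l\<rparr> else advance c)"
| "exec w (RJumpLess a b l) c =
     Some (if rreg c a < rreg c b then c\<lparr>pc := l\<rparr> else advance c)"
| "exec w Halt c = None"

definition step :: "nat \<Rightarrow> instr list \<Rightarrow> config \<Rightarrow> config \<Rightarrow> bool" where
  "step w P c c' \<longleftrightarrow> pc c < length P \<and> exec w (P ! pc c) c = Some c'"

definition halted :: "instr list \<Rightarrow> config \<Rightarrow> bool" where
  "halted P c \<longleftrightarrow> pc c < length P \<and> P ! pc c = Halt"

definition init_config :: "nat list \<Rightarrow> real list \<Rightarrow> real \<Rightarrow> real \<Rightarrow> config" where
  "init_config M R x1 x2 =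
     \<lparr>pc = 0, reg = (\<lambda>_. 0), rreg = (\<lambda>_. 0)(0 := x1, 1 := x2), mem = M, rmem = R\<rparr>"

text \<open>The result is returned in word register 0. The memory must be left as it was found, so
  that the structure can serve arbitrarily many queries.\<close>

definition answers ::
  "nat \<Rightarrow> instr list \<Rightarrow> nat list \<Rightarrow> real list \<Rightarrow> real \<Rightarrow> real \<Rightarrow> nat \<Rightarrow> nat \<Rightarrow> bool" where
  "answers w P M R x1 x2 t r \<longleftrightarrow>
     (\<exists>c. (step w P ^^ t) (init_config M R x1 x2) c \<and> halted P c \<and>
          reg c 0 = r \<and> mem c = M \<and> rmem c = R)"

section \<open>Resource bounds\<close>

definition soft_O :: "(nat \<Rightarrow> real) \<Rightarrow> (nat \<Rightarrow> real) set" where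
  "soft_O g = (\<Union>k. O(\<lambda>n. g n * ln (real n) ^ k))"

text \<open>One query program \<open>P\<close> serves all graphs; only the memory contents depend on the
  graph and its attributes. On graphs with \<open>n\<close> vertices the word length is \<open>w n\<close>, the
  structure occupies at most \<open>S n\<close> cells, and every query takes at most \<open>T n\<close> steps.\<close>

definition range_counting_structure ::
  "'q graph \<Rightarrow> 'v itself \<Rightarrow> instr list \<Rightarrow> (nat \<Rightarrow> nat) \<Rightarrow> (nat \<Rightarrow> nat) \<Rightarrow> (nat \<Rightarrow> nat) \<Rightarrow> bool" where
  "range_counting_structure Q TYPE('v) P w S T \<longleftrightarrow>
     (\<forall>(G :: 'v graph) (A :: 'v \<Rightarrow> real). simple_graph G \<longrightarrow>
       (let n = card (verts G) in
         \<exists>M R. (\<forall>a\<in>set M. a < 2 ^ w n) \<and> length M + length R \<le> S n \<and>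
           (\<forall>x1 x2. \<exists>t\<le>T n.
              answers (w n) P M R x1 x2 t (num_occurrences Q (range_subgraph G A x1 x2)))))"

end

theory Submission
  imports Defs "HOL-Library.Log_Nat" "HOL-Library.FuncSet"
begin

text \<open>
  For vertices sorted by attribute, \<open>G\<^sub>q\<close> is induced by a contiguous block of the order, so there
  are only \<open>O(n\<^sup>2)\<close> different answers and all of them can be tabulated. Each is at most
  \<open>n\<^sup>k\<close> for a pattern with \<open>k\<close> vertices, since a copy of \<open>Q\<close> is determined by a map from the
  vertices of \<open>Q\<close>; hence it fits into one word of \<open>O(log n)\<close> bits. A query locates the two ends
  of the block by binary search and looks up the answer.
\<close>

section \<open>Counting occurrences\<close>

text \<open>Every occurrence is the image of \<open>Q\<close> under the inverse of its isomorphism,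
  so \<open>copy\<close> maps the functions in \<open>F\<close> onto a superset of the occurrences.
  Overcounting is harmless: the bound only ensures that an answer fits in a word.\<close>

lemma num_occurrences_le:
  assumes Q: "simple_graph Q" and fin: "finite (verts G)"
  shows "num_occurrences Q G \<le> card (verts G) ^ card (verts Q)"
proof -
  have finQ: "finite (verts Q)" using Q by (simp add: simple_graph_def)
  define F where "F = verts Q \<rightarrow>\<^sub>E verts G"
  define copy where "copy g = \<lparr>verts = g ` verts Q, edges = (`) g ` edges Q\<rparr>" for g :: "_ \<Rightarrow> 'b"
  have "H \<in> copy ` F" if sub: "subgraph H G" and iso: "graph_iso H Q" for H
  proof -
    obtain f where f: "bij_betw f (verts H) (verts Q)" and e: "edges Q = (`) f ` edges H"
      using iso by (auto simp: graph_iso_def)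
    \<comment> \<open>Restricting makes \<open>g\<close> extensional, hence a member of the finite
      function space \<open>F\<close>.\<close>
    define g where "g = restrict (inv_into (verts H) f) (verts Q)"
    have g: "g (f x) = x" if "x \<in> verts H" for x
      using f that by (auto simp: g_def bij_betw_def)
    have sub_verts: "e \<subseteq> verts H" if "e \<in> edges H" for e
      using sub that by (fastforce simp: subgraph_def simple_graph_def)
    have vQ: "verts Q = f ` verts H" using f by (simp add: bij_betw_def)
    have "g ` f ` e = e" if "e \<subseteq> verts H" for e
    proof -
      have "g ` f ` e = (\<lambda>x. x) ` e"
        unfolding image_image using g that by (intro image_cong) auto
      then show ?thesis by simp
    qed
    then have "g ` verts Q = verts H" and "(`) g ` edges Q = edges H"
      using sub_verts by (force simp: vQ e image_image)+
    then have "H = copy g" by (simp add: copy_def)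
    moreover have "g \<in> F"
      using sub g by (auto simp: F_def vQ subgraph_def) (auto simp: g_def vQ)
    ultimately show ?thesis by blast
  qed
  then have "num_occurrences Q G \<le> card (copy ` F)"
    unfolding num_occurrences_def using fin finQ
    by (intro card_mono) (auto simp: F_def intro!: finite_PiE)
  also have "\<dots> \<le> card F" using fin finQ by (intro card_image_le) (auto simp: F_def intro!: finite_PiE)
  also have "\<dots> = card (verts G) ^ card (verts Q)" using finQ by (simp add: F_def card_PiE)
  finally show ?thesis .
qed

text \<open>Edges consist of vertices of \<open>G\<close>, so only the trace of \<open>U\<close> on
  \<open>verts G\<close> matters. This replaces an attribute interval by a block of ranks.\<close>

lemma induced_cong:
  assumes "simple_graph G" "verts G \<inter> U = verts G \<inter> W"
  shows "induced G U = induced G W"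
proof -
  have "e \<subseteq> verts G" if "e \<in> edges G" for e
    using assms(1) that by (fastforce simp: simple_graph_def)
  then have "e \<subseteq> U \<longleftrightarrow> e \<subseteq> W" if "e \<in> edges G" for e using assms(2) that by blast
  then show ?thesis using assms(2) by (auto simp: induced_def)
qed

section \<open>Prefixes of sorted lists\<close>

text \<open>A downward closed predicate holds on an initial segment of a sorted list. The length of
  that segment is the boundary that binary search finds.\<close>

lemma sorted_nth_iff_less_takeWhile:
  fixes xs :: "'a::linorder list"
  assumes "sorted xs" "\<And>x y. x \<le> y \<Longrightarrow> P y \<Longrightarrow> P x" "i < length xs"
  shows "P (xs ! i) \<longleftrightarrow> i < length (takeWhile P xs)"
proof
  assume "i < length (takeWhile P xs)"
  then show "P (xs ! i)" by (metis nth_mem set_takeWhileD takeWhile_nth)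
next
  assume P: "P (xs ! i)"
  show "i < length (takeWhile P xs)"
  proof (rule ccontr)
    let ?m = "length (takeWhile P xs)"
    assume "\<not> i < ?m"
    then have "?m \<le> i" "?m < length xs" using assms(3) by auto
    then have "P (xs ! ?m)" using assms P sorted_nth_mono by blast
    with \<open>?m < length xs\<close> show False by (simp add: nth_length_takeWhile)
  qed
qed

lemma set_take_sorted_key:
  fixes f :: "'a \<Rightarrow> 'b::linorder"
  assumes "sorted (map f vs)" "\<And>x y. x \<le> y \<Longrightarrow> P y \<Longrightarrow> P x"
  shows "set (take (length (takeWhile P (map f vs))) vs) = {v \<in> set vs. P (f v)}"
proof -
  have "set (take (length (takeWhile P (map f vs))) vs) =
      {vs ! i | i. i < length vs \<and> i < length (takeWhile P (map f vs))}"
    by (auto simp: in_set_conv_nth) (metis nth_take)+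
  also have "\<dots> = {vs ! i | i. i < length vs \<and> P (f (vs ! i))}"
    using sorted_nth_iff_less_takeWhile[OF assms(1), where P = P] assms(2) by auto
  also have "\<dots> = {v \<in> set vs. P (f v)}" by (auto simp: in_set_conv_nth)
  finally show ?thesis .
qed

section \<open>The query program\<close>

text \<open>The defining equation splits off the last step; splitting off the first lets the
  simplifier run a program forwards from a known configuration.\<close>

lemma relpowp_Suc_iff: "(R ^^ Suc n) x z \<longleftrightarrow> (\<exists>y. R x y \<and> (R ^^ n) y z)"
  by (metis relpowp_Suc_D2 relpowp_Suc_I2)

lemma relpowp_numeral_iff:
  "(R ^^ numeral k) x z \<longleftrightarrow> (\<exists>y. R x y \<and> (R ^^ pred_numeral k) y z)"
  by (simp add: numeral_eq_Suc relpowp_Suc_iff del: relpowp.simps(2))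

section \<open>Binary search as a relocatable subroutine\<close>

definition code_at :: "instr list \<Rightarrow> nat \<Rightarrow> instr list \<Rightarrow> bool" where
  "code_at P s B \<longleftrightarrow> s + length B \<le> length P \<and> (\<forall>i<length B. P ! (s + i) = B ! i)"

text \<open>Binary search in the interval between word registers 3 and 4, leaving the result in
  register 3. The flag selects whether an entry counts as lying to the left of the result when
  it is below the first query end point, or when it is at most the second one.\<close>

definition search :: "bool \<Rightarrow> nat \<Rightarrow> instr list" where
  "search below s =
    [JumpLess 3 4 (s + 2), Jump (s + 11),
     Op Add 5 3 4, Op Shr 5 5 2, RLoad 2 5,
     if below then RJumpLess 2 0 (s + 7) else RJumpLess 1 2 (s + 9),
     Jump (s + (if below then 9 else 7)),
     Op Add 3 5 2, Jump s,
     Move 4 5, Jump s]"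

text \<open>Strict at \<open>x1\<close> but not at \<open>x2\<close>, so that attributes equal to
  either end point fall inside the block.\<close>

definition left_of :: "bool \<Rightarrow> real \<Rightarrow> real \<Rightarrow> real \<Rightarrow> bool" where
  "left_of below x1 x2 y \<longleftrightarrow> (if below then y < x1 else y \<le> x2)"

text \<open>Word registers 3, 4, 5 and real register 2 are the work registers of the search.\<close>

definition same_frame :: "config \<Rightarrow> config \<Rightarrow> bool" where
  "same_frame c d \<longleftrightarrow> (\<forall>r. r \<notin> {3, 4, 5} \<longrightarrow> reg d r = reg c r) \<and>
     rreg d 0 = rreg c 0 \<and> rreg d 1 = rreg c 1 \<and> mem d = mem c \<and> rmem d = rmem c"

lemma search_exit:
  assumes "code_at P s (search below s)" "pc c = s" "reg c 3 \<ge> reg c 4"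
  shows "(step w P ^^ 2) c (c\<lparr>pc := s + 11\<rparr>)"
proof -
  have "s + 11 \<le> length P" and "P ! s = JumpLess 3 4 (s + 2)" and "P ! Suc s = Jump (s + 11)"
    using assms(1) by (auto simp: code_at_def search_def numeral_eq_Suc All_less_Suc2)
  then show ?thesis using assms(2,3)
    by (simp add: numeral_2_eq_2 relpowp_Suc_iff step_def del: relpowp.simps(2))
qed

text \<open>The bound on \<open>2 * length (rmem c)\<close> keeps the sum of the two interval ends
  from wrapping around. Register 2 holds 1 and serves both as shift amount and as increment.\<close>

lemma search_iteration:
  assumes code: "code_at P s (search below s)" and "pc c = s" "reg c 2 = 1"
    and "reg c 3 < reg c 4" "reg c 4 \<le> length (rmem c)" "2 * length (rmem c) < 2 ^ w"
  defines "m \<equiv> (reg c 3 + reg c 4) div 2"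
  shows "\<exists>t d. t \<le> 8 \<and> (step w P ^^ t) c d \<and> pc d = s \<and> same_frame c d \<and>
    (if left_of below (rreg c 0) (rreg c 1) (rmem c ! m)
     then reg d 3 = m + 1 \<and> reg d 4 = reg c 4 else reg d 3 = reg c 3 \<and> reg d 4 = m)"
proof -
  have code': "s + 11 \<le> length P"
    "P ! s = JumpLess 3 4 (s + 2)"
    "P ! (s + 2) = Op Add 5 3 4"
    "P ! Suc (s + 2) = Op Shr 5 5 2"
    "P ! Suc (Suc (s + 2)) = RLoad 2 5"
    "P ! Suc (Suc (Suc (s + 2))) = (if below then RJumpLess 2 0 (s + 7) else RJumpLess 1 2 (s + 9))"
    "P ! Suc (Suc (Suc (Suc (s + 2)))) = Jump (s + (if below then 9 else 7))"
    "P ! (s + 7) = Op Add 3 5 2"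
    "P ! Suc (s + 7) = Jump s"
    "P ! (s + 9) = Move 4 5"
    "P ! Suc (s + 9) = Jump s"
    using code by (auto simp: code_at_def search_def numeral_eq_Suc All_less_Suc2)
  have bounds: "reg c 3 + reg c 4 < 2 ^ w" "m < 2 ^ w" "Suc m < 2 ^ w" "m < length (rmem c)"
    using assms(4-6) by (auto simp: m_def)
  have half: "drop_bit (Suc 0) (reg c 3 + reg c 4) = m"
    by (simp add: m_def drop_bit_Suc)
  define p where "p = left_of below (rreg c 0) (rreg c 1) (rmem c ! m)"
  \<comment> \<open>The real comparison tests \<open>p\<close> itself if \<open>below\<close> holds
    and its negation otherwise, so it jumps exactly when \<open>below = p\<close>; falling through
    costs one more \<open>Jump\<close>.\<close>
  have "\<exists>d. (step w P ^^ (if below = p then 7 else 8 :: nat)) c d \<and> pc d = s \<and> same_frame c d \<and>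
    (if p then reg d 3 = m + 1 \<and> reg d 4 = reg c 4 else reg d 3 = reg c 3 \<and> reg d 4 = m)"
    using assms(2-4) code' bounds half
    by (cases below; cases p)
      (simp_all add: numeral_eq_Suc relpowp_Suc_iff step_def same_frame_def p_def left_of_def
        del: relpowp.simps(2))
  moreover have "(if below = p then 7 else 8 :: nat) \<le> 8" by simp
  ultimately show ?thesis unfolding p_def by blast
qed

lemma same_frame_trans: "same_frame c d \<Longrightarrow> same_frame d e \<Longrightarrow> same_frame c e"
  by (simp add: same_frame_def)

text \<open>The boundary \<open>m\<close> stays between registers 3 and 4 while their distance
  halves: at most \<open>k\<close> rounds of 8 steps, then 2 steps to leave the loop.\<close>

lemma search_correct:
  assumes "code_at P s (search below s)" "2 * length (rmem c) < 2 ^ w"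
    and "\<forall>i<length (rmem c). left_of below (rreg c 0) (rreg c 1) (rmem c ! i) \<longleftrightarrow> i < m"
    and "pc c = s" "reg c 2 = 1" "reg c 3 \<le> m" "m \<le> reg c 4" "reg c 4 \<le> length (rmem c)"
    and "reg c 4 - reg c 3 < 2 ^ k"
  shows "\<exists>t d. t \<le> 8 * k + 2 \<and> (step w P ^^ t) c d \<and> pc d = s + 11 \<and> same_frame c d \<and> reg d 3 = m"
  using assms
proof (induction k arbitrary: c)
  case 0
  then have "reg c 3 = m" "reg c 4 \<le> reg c 3" by simp_all
  moreover have "same_frame c (c\<lparr>pc := s + 11\<rparr>)" by (simp add: same_frame_def)
  ultimately show ?case using search_exit[OF 0(1,4), of w]
    by (intro exI[of _ 2] exI[of _ "c\<lparr>pc := s + 11\<rparr>"]) simp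
next
  case (Suc k)
  show ?case
  proof (cases "reg c 3 < reg c 4")
    case False
    then have "reg c 3 = m" "reg c 4 \<le> reg c 3" using Suc.prems by simp_all
    moreover have "same_frame c (c\<lparr>pc := s + 11\<rparr>)" by (simp add: same_frame_def)
    ultimately show ?thesis using search_exit[OF Suc.prems(1,4), of w]
      by (intro exI[of _ 2] exI[of _ "c\<lparr>pc := s + 11\<rparr>"]) simp
  next
    case True
    let ?mid = "(reg c 3 + reg c 4) div 2"
    obtain t d where d: "t \<le> 8" "(step w P ^^ t) c d" "pc d = s" "same_frame c d"
      "if left_of below (rreg c 0) (rreg c 1) (rmem c ! ?mid)
       then reg d 3 = ?mid + 1 \<and> reg d 4 = reg c 4 else reg d 3 = reg c 3 \<and> reg d 4 = ?mid"
      using search_iteration[OF Suc.prems(1,4,5) True Suc.prems(8,2)] by auto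
    have mid: "?mid < length (rmem c)" using True Suc.prems(8) by linarith
    then have dm: "if ?mid < m
       then reg d 3 = ?mid + 1 \<and> reg d 4 = reg c 4 else reg d 3 = reg c 3 \<and> reg d 4 = ?mid"
      using d(5) Suc.prems(3) by simp
    have frame: "rmem d = rmem c" "rreg d 0 = rreg c 0" "rreg d 1 = rreg c 1" "reg d 2 = reg c 2"
      using d(4) by (auto simp: same_frame_def)
    \<comment> \<open>From distance \<open>l\<close>, the left part keeps \<open>l div 2\<close>,
      and the right part, which skips the midpoint, at most that.\<close>
    have "reg d 4 - reg d 3 < 2 ^ k" "reg d 3 \<le> m" "m \<le> reg d 4" "reg d 4 \<le> length (rmem c)"
      using dm mid Suc.prems(6-9) True by (auto split: if_splits)
    then obtain t' e where e: "t' \<le> 8 * k + 2" "(step w P ^^ t') d e" "pc e = s + 11"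
      "same_frame d e" "reg e 3 = m"
      using Suc.IH[of d] Suc.prems(1,2,3,5) d(3) unfolding frame by blast
    have "(step w P ^^ (t + t')) c e" using d(2) e(2) by (metis relpowp_add relcomppI)
    moreover have "t + t' \<le> 8 * Suc k + 2" using d(1) e(1) by simp
    ultimately show ?thesis using e same_frame_trans[OF d(4) e(4)] by blast
  qed
qed

section \<open>Table layout and correctness of a complete query\<close>

text \<open>Cell 0 holds the number \<open>n\<close> of vertices; the answer for the block of ranks from \<open>i\<close> to
  \<open>j\<close> is in cell \<open>i (n + 1) + j + 1\<close>.\<close>

definition query :: "instr list" where
  "query = [Load 1 0, Const 2 1, Move 4 1] @ search True 3 @
    [Op Add 7 1 2, Op Mul 6 3 7, Op Add 6 6 2, Const 3 0, Move 4 1] @ search False 19 @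
    [Op Add 6 6 3, Load 0 6, Halt]"

definition table :: "nat \<Rightarrow> (nat \<Rightarrow> nat \<Rightarrow> nat) \<Rightarrow> nat list" where
  "table n f = n # map (\<lambda>k. f (k div (n + 1)) (k mod (n + 1))) [0..<(n + 1)\<^sup>2]"

lemma table_index:
  fixes i j n :: nat
  assumes "i \<le> n" "j \<le> n"
  shows "i * (n + 1) + j < (n + 1)\<^sup>2"
proof -
  have "i * (n + 1) + j < i * (n + 1) + (n + 1)" using assms(2) by simp
  also have "\<dots> = (i + 1) * (n + 1)" by simp
  also have "\<dots> \<le> (n + 1) * (n + 1)" using assms by (intro mult_right_mono) auto
  finally show ?thesis by (simp add: power2_eq_square)
qed

text \<open>The 1 that skips cell 0 precedes \<open>j\<close> because the program adds it before the
  second search.\<close>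

lemma table_nth:
  assumes "i \<le> n" "j \<le> n"
  shows "table n f ! (i * (n + 1) + 1 + j) = f i j"
proof -
  have "(i * (n + 1) + j) div (n + 1) = i" "(i * (n + 1) + j) mod (n + 1) = j"
    using assms by (simp_all only: div_mult_self3 mod_mult_self3, auto)
  then show ?thesis using table_index[OF assms] by (simp add: table_def del: mult_Suc_right)
qed

lemma length_table: "length (table n f) = (n + 1)\<^sup>2 + 1"
  by (simp add: table_def)

text \<open>The budget consists of 3 + 5 + 2 straight-line steps and two searches of at most
  \<open>8 * L + 2\<close> steps each.\<close>

lemma query_answers:
  fixes R :: "real list"
  assumes "sorted R" and n: "length R = n" and "n < 2 ^ L" and w: "(n + 1)\<^sup>2 + 1 < 2 ^ w"
  shows "\<exists>t \<le> 16 * L + 14. answers w query (table n f) R x1 x2 t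
    (f (length (takeWhile (\<lambda>y. y < x1) R)) (length (takeWhile (\<lambda>y. y \<le> x2) R)))"
proof -
  define i where "i = length (takeWhile (\<lambda>y. y < x1) R)"
  define j where "j = length (takeWhile (\<lambda>y. y \<le> x2) R)"
  let ?M = "table n f"
  have i: "i \<le> n" and j: "j \<le> n"
    unfolding i_def j_def n[symmetric] by (rule length_takeWhile_le)+
  have "2 * n \<le> (n + 1)\<^sup>2" "n + 1 \<le> (n + 1)\<^sup>2" by (simp_all add: power2_eq_square)
  then have small: "2 * n < 2 ^ w" "n + 1 < 2 ^ w" "1 < (2 :: nat) ^ w" using w by simp_all
  have "0 < w" using small(3) by (cases w) simp_all
  have addr: "i * (n + 1) + 1 + j < length ?M" using table_index[OF i j] by (simp add: length_table)
  then have addr_small: "i * (n + 1) + 1 + j < 2 ^ w" using w by (simp add: length_table)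
  \<comment> \<open>A search block has 11 instructions: the first ends at 14, and 5 instructions
    later the second starts at 19.\<close>
  have code: "code_at query 3 (search True 3)" "code_at query 19 (search False 19)"
    by (simp_all add: code_at_def query_def search_def numeral_eq_Suc All_less_Suc2)
  have R: "\<forall>k<length R. left_of True x1 x2 (R ! k) \<longleftrightarrow> k < i"
    "\<forall>k<length R. left_of False x1 x2 (R ! k) \<longleftrightarrow> k < j"
    using sorted_nth_iff_less_takeWhile[OF assms(1), of "\<lambda>y. y < x1"]
      sorted_nth_iff_less_takeWhile[OF assms(1), of "\<lambda>y. y \<le> x2"]
    by (simp_all add: left_of_def i_def j_def)

  have "\<exists>c. (step w query ^^ 3) (init_config ?M R x1 x2) c \<and> pc c = 3 \<and> reg c 1 = n \<and>
      reg c 2 = 1 \<and> reg c 3 = 0 \<and> reg c 4 = n \<and> rreg c 0 = x1 \<and> rreg c 1 = x2 \<and>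
      mem c = ?M \<and> rmem c = R"
    using small \<open>0 < w\<close>
    by (simp add: relpowp_numeral_iff relpowp_Suc_iff step_def query_def init_config_def table_def
        del: relpowp.simps(2))
  then obtain c1 where c1: "(step w query ^^ 3) (init_config ?M R x1 x2) c1" "pc c1 = 3"
    "reg c1 1 = n" "reg c1 2 = 1" "reg c1 3 = 0" "reg c1 4 = n" "rreg c1 0 = x1" "rreg c1 1 = x2"
    "mem c1 = ?M" "rmem c1 = R" by blast
  obtain t1 c2 where t1: "t1 \<le> 8 * L + 2" "(step w query ^^ t1) c1 c2" "pc c2 = 14"
    "same_frame c1 c2" "reg c2 3 = i"
    using search_correct[OF code(1), of c1 w i L] R c1 i n small(1) assms(3) by auto
  have c2: "reg c2 1 = n" "reg c2 2 = 1" "rreg c2 0 = x1" "rreg c2 1 = x2" "mem c2 = ?M" "rmem c2 = R"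
    using t1(4) c1 by (auto simp: same_frame_def)

  have "\<exists>c. (step w query ^^ 5) c2 c \<and> pc c = 19 \<and> reg c 6 = i * (n + 1) + 1 \<and>
      reg c 2 = 1 \<and> reg c 3 = 0 \<and> reg c 4 = n \<and> rreg c 0 = x1 \<and> rreg c 1 = x2 \<and>
      mem c = ?M \<and> rmem c = R"
    using small addr_small t1(3,5) c2
    by (simp add: relpowp_numeral_iff relpowp_Suc_iff step_def query_def search_def
        del: relpowp.simps(2) mult_Suc_right)
  then obtain c3 where c3: "(step w query ^^ 5) c2 c3" "pc c3 = 19"
    "reg c3 6 = i * (n + 1) + 1" "reg c3 2 = 1" "reg c3 3 = 0" "reg c3 4 = n"
    "rreg c3 0 = x1" "rreg c3 1 = x2" "mem c3 = ?M" "rmem c3 = R" by blast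
  obtain t2 c4 where t2: "t2 \<le> 8 * L + 2" "(step w query ^^ t2) c3 c4" "pc c4 = 30"
    "same_frame c3 c4" "reg c4 3 = j"
    using search_correct[OF code(2), of c3 w j L] R c3 j n small(1) assms(3) by auto
  \<comment> \<open>The row offset survives the second search because register 6 is not one of its
    work registers.\<close>
  have c4: "reg c4 6 = i * (n + 1) + 1" "mem c4 = ?M" "rmem c4 = R"
    using t2(4) c3 by (auto simp: same_frame_def)

  have "\<exists>c. (step w query ^^ 2) c4 c \<and> pc c = 32 \<and>
      reg c 0 = ?M ! (i * (n + 1) + 1 + j) \<and> mem c = ?M \<and> rmem c = R"
    using addr addr_small t2(3,5) c4
    by (simp add: relpowp_numeral_iff relpowp_Suc_iff step_def query_def search_def
        del: relpowp.simps(2) mult_Suc_right)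
  then obtain c5 where c5: "(step w query ^^ 2) c4 c5" "pc c5 = 32"
    "reg c5 0 = f i j" "mem c5 = ?M" "rmem c5 = R"
    using table_nth[OF i j] by metis
  have "(step w query ^^ (3 + (t1 + (5 + (t2 + 2))))) (init_config ?M R x1 x2) c5"
    using c1(1) t1(2) c3(1) t2(2) c5(1) unfolding relpowp_add by blast
  moreover have "halted query c5" using c5(2) by (simp add: halted_def query_def search_def)
  ultimately have "answers w query ?M R x1 x2 (3 + (t1 + (5 + (t2 + 2)))) (f i j)"
    using c5 unfolding answers_def by blast
  moreover have "3 + (t1 + (5 + (t2 + 2))) \<le> 16 * L + 14" using t1(1) t2(1) by simp
  ultimately show ?thesis unfolding i_def j_def by blast
qed

section \<open>The data structure\<close>

definition word_length :: "nat \<Rightarrow> nat \<Rightarrow> nat" where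
  "word_length k n = (k + 3) * (floorlog 2 n + 1)"

lemma less_two_power_floorlog: "n < 2 ^ floorlog 2 n"
  using floorlog_leD[of 2 n "floorlog 2 n"] by simp

text \<open>With \<open>L\<close> binary digits in \<open>n\<close>, addresses need at most
  \<open>2 * L + 3\<close> bits and answers at most \<open>k * L + 1\<close>;
  \<open>(k + 3) * (L + 1)\<close> covers both.\<close>

lemma word_length_bounds:
  shows "(n + 1)\<^sup>2 + 1 < 2 ^ word_length k n" and "n ^ k < 2 ^ word_length k n"
proof -
  let ?L = "floorlog 2 n"
  have "(n + 1)\<^sup>2 \<le> (2 ^ ?L)\<^sup>2"
    using less_two_power_floorlog[of n] by (intro power_mono) auto
  also have "\<dots> = 2 ^ (2 * ?L)" by (simp add: power_mult[symmetric] mult.commute)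
  finally have "(n + 1)\<^sup>2 + 1 < 2 ^ (2 * ?L) * 2 ^ 3"
    using zero_less_power[of "2 :: nat" "2 * ?L"] unfolding power3_eq_cube by linarith
  also have "\<dots> = 2 ^ (2 * ?L + 3)" by (simp add: power_add)
  also have "\<dots> \<le> 2 ^ word_length k n"
    by (intro power_increasing) (auto simp: word_length_def algebra_simps)
  finally show "(n + 1)\<^sup>2 + 1 < 2 ^ word_length k n" .
  have "n ^ k \<le> (2 ^ ?L) ^ k" using less_two_power_floorlog[of n] by (intro power_mono) auto
  also have "\<dots> = 2 ^ (?L * k)" by (simp add: power_mult)
  also have "\<dots> < 2 ^ word_length k n"
    by (intro power_strict_increasing) (auto simp: word_length_def algebra_simps)
  finally show "n ^ k < 2 ^ word_length k n" .
qed

lemma floorlog_bigo: "(\<lambda>n. real (floorlog 2 n)) \<in> O(\<lambda>n. ln (real n))"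
proof (rule bigoI)
  \<comment> \<open>From \<open>n = 2\<close> on, \<open>log 2 n\<close> is at least 1 and absorbs
    the additional digit, hence the factor 2.\<close>
  have "norm (real (floorlog 2 n)) \<le> 2 / ln 2 * norm (ln (real n))" if "n \<ge> 2" for n
  proof -
    have "real (floorlog 2 n) \<le> log 2 (real n) + 1"
      using that by (simp add: floorlog_def of_nat_nat)
    moreover have "1 \<le> log 2 (real n)" using that by simp
    ultimately have "real (floorlog 2 n) \<le> 2 * log 2 (real n)" by linarith
    then show ?thesis using that by (simp add: log_def)
  qed
  then show "\<forall>\<^sub>F n in at_top. norm (real (floorlog 2 n)) \<le> 2 / ln 2 * norm (ln (real n))"
    using eventually_at_top_linorder by blast
qed

lemma const_bigo_ln: "(\<lambda>n. c) \<in> O(\<lambda>n. ln (real n))" for c :: real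
proof (rule bigoI)
  have "filterlim (\<lambda>n. ln (real n)) at_top sequentially"
    by (rule filterlim_compose[OF ln_at_top filterlim_real_sequentially])
  then have "\<forall>\<^sub>F n in sequentially. 1 \<le> ln (real n)" by (simp add: filterlim_at_top)
  then show "\<forall>\<^sub>F n in sequentially. norm c \<le> norm c * norm (ln (real n))"
    by eventually_elim (simp add: mult_left_le mult_le_cancel_left1)
qed

lemma range_counting_structure_query:
  fixes Q :: "'q graph"
  assumes "simple_graph Q"
  shows "range_counting_structure Q TYPE('v) query (word_length (card (verts Q)))
    (\<lambda>n. (n + 1)\<^sup>2 + 1 + n) (\<lambda>n. 16 * floorlog 2 n + 14)"
  unfolding range_counting_structure_def Let_def
proof (intro allI impI)
  fix G :: "'v graph" and A :: "'v \<Rightarrow> real"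
  assume G: "simple_graph G"
  let ?n = "card (verts G)" and ?k = "card (verts Q)"
  let ?w = "word_length ?k ?n"
  have fin: "finite (verts G)" using G by (simp add: simple_graph_def)
  then obtain xs where xs: "set xs = verts G" "distinct xs" using finite_distinct_list by blast
  define vs where "vs = sort_key A xs"
  define R where "R = map A vs"
  have vs: "set vs = verts G" "length vs = ?n" "sorted (map A vs)"
    using xs by (auto simp: vs_def distinct_card[symmetric])
  \<comment> \<open>The set difference is the block of 0-based positions from \<open>i\<close> up to
    but excluding \<open>j\<close>; it is empty when \<open>j \<le> i\<close>, which handles
    \<open>x2 < x1\<close>.\<close>
  define f where "f i j = num_occurrences Q (induced G (set (take j vs) - set (take i vs)))" for i j
  have f_less: "f i j < 2 ^ ?w" for i j
  proof -
    let ?U = "set (take j vs) - set (take i vs)"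
    have "f i j \<le> card (verts (induced G ?U)) ^ ?k"
      unfolding f_def using assms fin by (intro num_occurrences_le) (auto simp: induced_def)
    also have "\<dots> \<le> ?n ^ ?k"
      using fin by (intro power_mono card_mono) (auto simp: induced_def)
    also have "\<dots> < 2 ^ ?w" by (rule word_length_bounds)
    finally show ?thesis .
  qed
  have n_less: "?n < 2 ^ ?w"
    using word_length_bounds(1)[of ?n ?k] by (simp add: power2_eq_square)
  have correct: "f (length (takeWhile (\<lambda>y. y < x1) R)) (length (takeWhile (\<lambda>y. y \<le> x2) R)) =
      num_occurrences Q (range_subgraph G A x1 x2)" for x1 x2
    unfolding f_def range_subgraph_def R_def using vs(1)
      set_take_sorted_key[OF vs(3), of "\<lambda>y. y < x1"] set_take_sorted_key[OF vs(3), of "\<lambda>y. y \<le> x2"]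
    by (intro arg_cong[where f = "num_occurrences Q"] induced_cong[OF G]) auto
  have "\<exists>t\<le>16 * floorlog 2 ?n + 14.
      answers ?w query (table ?n f) R x1 x2 t (num_occurrences Q (range_subgraph G A x1 x2))" for x1 x2
    unfolding correct[symmetric] using vs less_two_power_floorlog word_length_bounds(1)
    by (intro query_answers) (auto simp: R_def)
  moreover have "\<forall>a\<in>set (table ?n f). a < 2 ^ ?w" using f_less n_less by (auto simp: table_def)
  moreover have "length (table ?n f) + length R \<le> (?n + 1)\<^sup>2 + 1 + ?n"
    using vs by (simp add: length_table R_def)
  ultimately show "\<exists>M R. (\<forall>a\<in>set M. a < 2 ^ ?w) \<and> length M + length R \<le> (?n + 1)\<^sup>2 + 1 + ?n \<and>
      (\<forall>x1 x2. \<exists>t\<le>16 * floorlog 2 ?n + 14.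
        answers ?w query M R x1 x2 t (num_occurrences Q (range_subgraph G A x1 x2)))"
    by blast
qed

theorem theorem4:
  fixes Q :: "'q graph"
  assumes "simple_graph Q" and "connected_graph Q"
  shows "\<exists>(P :: instr list) (w :: nat \<Rightarrow> nat) (S :: nat \<Rightarrow> nat) (T :: nat \<Rightarrow> nat).
    (\<lambda>n. real (w n)) \<in> O(\<lambda>n. ln (real n)) \<and>
    (\<lambda>n. real (S n)) \<in> O(\<lambda>n. real n ^ 2) \<and>
    (\<lambda>n. real (T n)) \<in> soft_O (\<lambda>n. 1) \<and>
    range_counting_structure Q TYPE('v) P w S T"
proof -
  let ?S = "\<lambda>n :: nat. (n + 1)\<^sup>2 + 1 + n" and ?T = "\<lambda>n. 16 * floorlog 2 n + 14"
  have "(\<lambda>n. real (word_length (card (verts Q)) n)) \<in> O(\<lambda>n. ln (real n))"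
    unfolding word_length_def of_nat_mult of_nat_add
    by (simp add: sum_in_bigo floorlog_bigo const_bigo_ln)
  moreover have "(\<lambda>n. real (?S n)) \<in> O(\<lambda>n. real n ^ 2)"
  proof (rule bigoI)
    \<comment> \<open>The size is \<open>n^2 + 3 * n + 2\<close>, and each of \<open>n\<close> and 1
      is at most \<open>n^2\<close>, giving 1 + 3 + 2.\<close>
    have "norm (real (?S n)) \<le> 6 * norm (real n ^ 2)" if "n \<ge> 1" for n
    proof -
      have "n \<le> n\<^sup>2" "1 \<le> n\<^sup>2" using that by (auto simp: power2_eq_square)
      moreover have "(n + 1)\<^sup>2 = n\<^sup>2 + 2 * n + 1" by (simp add: power2_eq_square)
      ultimately have "?S n \<le> 6 * n\<^sup>2" by linarith
      then have "real (?S n) \<le> real (6 * n\<^sup>2)" by (rule of_nat_mono)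
      then show ?thesis by simp
    qed
    then show "\<forall>\<^sub>F n in at_top. norm (real (?S n)) \<le> 6 * norm (real n ^ 2)"
      using eventually_at_top_linorder by blast
  qed
  moreover have "(\<lambda>n. real (?T n)) \<in> soft_O (\<lambda>n. 1)"
  proof -
    have "(\<lambda>n. real (?T n)) \<in> O(\<lambda>n. ln (real n))"
      unfolding of_nat_mult of_nat_add
      by (simp add: sum_in_bigo floorlog_bigo const_bigo_ln)
    \<comment> \<open>A single logarithmic factor suffices, so the exponent in \<open>soft_O\<close>
      is 1.\<close>
    then have "(\<lambda>n. real (?T n)) \<in> O(\<lambda>n. 1 * ln (real n) ^ 1)" by simp
    then show ?thesis unfolding soft_O_def by blast
  qed
  moreover have "range_counting_structure Q TYPE('v) query (word_length (card (verts Q))) ?S ?T"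
    using assms(1) by (rule range_counting_structure_query)
  ultimately show ?thesis
    by (intro exI[of _ query] exI[of _ "word_length (card (verts Q))"] exI[of _ ?S] exI[of _ ?T] conjI)
qed

end
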